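(* In the setting of the context, the ADMM iteration for the problem $$\min_{\Pi_d\in\mathcal{F}_d,\ \Pi_s\in\mathcal{F}_s,\ \Pi}\ -\sum_{t\in\mathcal{T}}\sum_{x\in\mathcal{X}}\sum_{y\in\mathcal{Y}_x} d_{xy}(\pi_{xy}^{t,d})-\sum_{t\in\mathcal{T}}\sum_{y\in\mathcal{Y}}\sum_{x\in\mathcal{X}_y}\bigl(s_{xy}(\pi_{xy}^{t,s})-c_{xy}(\pi_{xy}^{t,s})\bigr)-\sum_{x\in\mathcal{X}}\omega_x f_x\Bigl(\sum_{t\in\mathcal{T}}\sum_{y\in\mathcal{Y}_x}\pi_{xy}^{t,d}\Bigr)$$ subject to $\pi_{xy}^{t,d}=\pi_{xy}^t$ and $\pi_{xy}^t=\pi_{xy}^{t,s}$ for all $t\in\mathcal{T}$, $\{x,y\}\in\mathcal{E}$, is equivalent to the following iteration. That is, a sequence $(\Pi_d(k),\Pi_s(k),\Pi(k),\alpha^d(k),\alpha^s(k))_{k\ge 0}$ satisfies the ADMM iteration for all $k\ge 0$ if and only if for all $k\ge 0$ the following hold. (i) For every $x\in\mathcal{X}$, $$\Pi_x^d(k+1)\in\arg\min_{\Pi_x^d\in\mathcal{F}_x^d}\ -\sum_{t\in\mathcal{T}}\sum_{y\in\mathcal{Y}_x} d_{xy}(\pi_{xy}^{t,d})-\omega_x f_x\Bigl(\sum_{t\in\mathcal{T}}\sum_{y\in\mathcal{Y}_x}\pi_{xy}^{t,d}\Bigr)+\sum_{t\in\mathcal{T}}\sum_{y\in\mathcal{Y}_x}\alpha_{xy}^{t,d}(k)\pi_{xy}^{t,d}+\frac{\eta}{2}\sum_{t\in\mathcal{T}}\sum_{y\in\mathcal{Y}_x}\bigl(\pi_{xy}^{t,d}-\pi_{xy}^t(k)\bigr)^2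 .$$ (ii) For every $y\in\mathcal{Y}$, $$\Pi_y^s(k+1)\in\arg\min_{\Pi_y^s\in\mathcal{F}_y^s}\ -\sum_{t\in\mathcal{T}}\sum_{x\in\mathcal{X}_y}\bigl(s_{xy}(\pi_{xy}^{t,s})-c_{xy}(\pi_{xy}^{t,s})\bigr)-\sum_{t\in\mathcal{T}}\sum_{x\in\mathcal{X}_y}\alpha_{xy}^{t,s}(k)\pi_{xy}^{t,s}+\frac{\eta}{2}\sum_{t\in\mathcal{T}}\sum_{x\in\mathcal{X}_y}\bigl(\pi_{xy}^t(k)-\pi_{xy}^{t,s}\bigr)^2 .$$ (iii) For every $\{x,y\}\in\mathcal{E}$, $$\Pi_{xy}(k+1)=\arg\min_{\Pi_{xy}}\ -\sum_{t\in\mathcal{T}}\alpha_{xy}^{t,d}(k)\pi_{xy}^t+\sum_{t\in\mathcal{T}}\alpha_{xy}^{t,s}(k)\pi_{xy}^t+\frac{\eta}{2}\sum_{t\in\mathcal{T}}\bigl(\pi_{xy}^{t,d}(k+1)-\pi_{xy}^t\bigr)^2+\frac{\eta}{2}\sum_{t\in\mathcal{T}}\bigl(\pi_{xy}^t-\pi_{xy}^{t,s}(k+1)\bigr)^2 .$$ (iv) For every $t\in\mathcal{T}$ and $\{x,y\}\in\mathcal{E}$, $\ \alpha_{xy}^{t,d}(k+1)=\alpha_{xy}^{t,d}(k)+\eta\bigl(\pi_{xy}^{t,d}(k+1)-\pi_{xy}^t(k+1)\bigr)$. (v) For every $t\in\mathcal{T}$ and $\{x,y\}\in\mathcal{E}$,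 $\ \alpha_{xy}^{t,s}(k+1)=\alpha_{xy}^{t,s}(k)+\eta\bigl(\pi_{xy}^t(k+1)-\pi_{xy}^{t,s}(k+1)\bigr)$.
   Context: Network. $\mathcal{X}=\{1,\dots,|\mathcal{X}|\}$ is a finite set of target nodes, $\mathcal{Y}=\{1,\dots,|\mathcal{Y}|\}$ a finite set of source nodes, and $\mathcal{T}=\{1,\dots,T\}$ a set of time periods. $\mathcal{E}$ is the edge set of a bipartite graph between $\mathcal{X}$ and $\mathcal{Y}$; an edge is written $\{x,y\}$ with $x\in\mathcal{X}$, $y\in\mathcal{Y}$. $\mathcal{X}_y=\{x:\{x,y\}\in\mathcal{E}\}$ and $\mathcal{Y}_x=\{y:\{x,y\}\in\mathcal{E}\}$ are all nonempty. Data. $d_{xy},s_{xy},c_{xy}:\mathbb{R}_+\to\mathbb{R}$ for $\{x,y\}\in\mathcal{E}$ and $f_x:\mathbb{R}_+\to\mathbb{R}$ for $x\in\mathcal{X}$, where $\mathbb{R}_+=[0,\infty)$. The functions $d_{xy},s_{xy},f_x$ are concave and monotonically increasing, and $c_{xy}$ is convex and monotonically increasing. Constants: $\omega_x\ge 0$, $\bar p_x\ge\underline p_x\ge 0$ ($x\in\mathcal{X}$), $\bar q_y\ge\underline q_y\ge 0$ ($y\in\mathcal{Y}$), $\eta>0$. Variables. $\Pi_d=\{\pi_{xy}^{t,d}\}$, $\Pi_s=\{\pi_{xy}^{t,s}\}$, $\Pi=\{\pi_{xy}^t\}$, $\alpha^d=\{\alpha_{xy}^{t,d}\}$, $\alpha^s=\{\alpha_{xy}^{t,s}\}$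 are real families indexed by $\{x,y\}\in\mathcal{E}$, $t\in\mathcal{T}$. Write $\Pi_x^d=\{\pi_{xy}^{t,d}\}_{y\in\mathcal{Y}_x,t\in\mathcal{T}}$ for fixed $x$, $\Pi_y^s=\{\pi_{xy}^{t,s}\}_{x\in\mathcal{X}_y,t\in\mathcal{T}}$ for fixed $y$, and $\Pi_{xy}=\{\pi_{xy}^t\}_{t\in\mathcal{T}}$ for a fixed edge ($\Pi_{xy}$ ranges over $\mathbb{R}^{T}$, unconstrained). Constraint sets. $\mathcal{F}_d=\{\Pi_d:\pi_{xy}^{t,d}\ge 0\ \forall \{x,y\}\in\mathcal{E},t\in\mathcal{T};\ \underline p_x\le\sum_{t\in\mathcal{T}}\sum_{y\in\mathcal{Y}_x}\pi_{xy}^{t,d}\le\bar p_x\ \forall x\in\mathcal{X}\}$; $\mathcal{F}_s=\{\Pi_s:\pi_{xy}^{t,s}\ge 0\ \forall \{x,y\}\in\mathcal{E},t\in\mathcal{T};\ \underline q_y\le\sum_{t\in\mathcal{T}}\sum_{x\in\mathcal{X}_y}\pi_{xy}^{t,s}\le\bar q_y\ \forall y\in\mathcal{Y}\}$; $\mathcal{F}_x^d=\{\Pi_x^d:\pi_{xy}^{t,d}\ge 0\ \forall y\in\mathcal{Y}_x,t\in\mathcal{T};\ \underline p_x\le\sum_{t}\sum_{y\in\mathcal{Y}_x}\pi_{xy}^{t,d}\le\bar p_x\}$; $\mathcal{F}_y^s=\{\Pi_y^s:\pi_{xy}^{t,s}\ge 0\ \forall x\in\mathcal{X}_y,t\in\mathcal{T};\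 \underline q_y\le\sum_{t}\sum_{x\in\mathcal{X}_y}\pi_{xy}^{t,s}\le\bar q_y\}$. Augmented Lagrangian. $$\begin{aligned}L(\Pi_d,\Pi_s,\Pi,\alpha^s,\alpha^d)=&-\sum_{t}\sum_{x\in\mathcal{X}}\sum_{y\in\mathcal{Y}_x}d_{xy}(\pi_{xy}^{t,d})-\sum_t\sum_{y\in\mathcal{Y}}\sum_{x\in\mathcal{X}_y}\bigl(s_{xy}(\pi_{xy}^{t,s})-c_{xy}(\pi_{xy}^{t,s})\bigr)-\sum_{x\in\mathcal{X}}\omega_xf_x\Bigl(\sum_t\sum_{y\in\mathcal{Y}_x}\pi_{xy}^{t,d}\Bigr)\\&+\sum_t\sum_{x\in\mathcal{X}}\sum_{y\in\mathcal{Y}_x}\alpha_{xy}^{t,d}(\pi_{xy}^{t,d}-\pi_{xy}^t)+\sum_t\sum_{y\in\mathcal{Y}}\sum_{x\in\mathcal{X}_y}\alpha_{xy}^{t,s}(\pi_{xy}^t-\pi_{xy}^{t,s})\\&+\frac{\eta}{2}\sum_t\sum_{x\in\mathcal{X}}\sum_{y\in\mathcal{Y}_x}(\pi_{xy}^{t,d}-\pi_{xy}^t)^2+\frac{\eta}{2}\sum_t\sum_{y\in\mathcal{Y}}\sum_{x\in\mathcal{X}_y}(\pi_{xy}^t-\pi_{xy}^{t,s})^2.\end{aligned}$$ ADMM iteration. For each $k\ge 0$: (1) $(\Pi_d(k+1),\Pi_s(k+1))\in\arg\min_{\Pi_d\in\mathcal{F}_d,\Pi_s\in\mathcal{F}_s}L(\Pi_d,\Pi_s,\Pi(k),\alpha^s(k),\alpha^d(k))$;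 (2) $\Pi(k+1)=\arg\min_{\Pi}L(\Pi_d(k+1),\Pi_s(k+1),\Pi,\alpha^s(k),\alpha^d(k))$; (3) each multiplier is increased by $\eta$ times the residual of its constraint as it appears in $L$: $\alpha_{xy}^{t,d}(k+1)=\alpha_{xy}^{t,d}(k)+\eta(\pi_{xy}^{t,d}(k+1)-\pi_{xy}^t(k+1))$ and $\alpha_{xy}^{t,s}(k+1)=\alpha_{xy}^{t,s}(k)+\eta(\pi_{xy}^t(k+1)-\pi_{xy}^{t,s}(k+1))$. *)

theory Defs
  imports "HOL-Analysis.Analysis"
begin

definition argmin_set :: "('a \<Rightarrow> real) \<Rightarrow> 'a set \<Rightarrow> 'a set" where
  "argmin_set g S = {z. is_arg_min g (\<lambda>z. z \<in> S) z}"

text \<open>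
  Target and source nodes are both numbered from 1, so the edge between target x and
  source y is encoded as the ordered pair (x, y).  The data functions are only meaningful on
  the nonnegative reals and on edges (respectively nodes); all conditions on them
  are restricted accordingly.
\<close>

record network =
  n_targets :: nat
  n_sources :: nat
  n_periods :: nat
  edges :: "(nat \<times> nat) set"
  dfun :: "nat \<Rightarrow> nat \<Rightarrow> real \<Rightarrow> real"
  sfun :: "nat \<Rightarrow> nat \<Rightarrow> real \<Rightarrow> real"
  cfun :: "nat \<Rightarrow> nat \<Rightarrow> real \<Rightarrow> real"
  ffun :: "nat \<Rightarrow> real \<Rightarrow> real"
  weight :: "nat \<Rightarrow> real"
  p_lo :: "nat \<Rightarrow> real"
  p_hi :: "nat \<Rightarrow> real"
  q_lo :: "nat \<Rightarrow> real"
  q_hi :: "nat \<Rightarrow> real"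
  penalty :: real

definition targets :: "network \<Rightarrow> nat set" where
  "targets N = {1..n_targets N}"

definition sources :: "network \<Rightarrow> nat set" where
  "sources N = {1..n_sources N}"

definition periods :: "network \<Rightarrow> nat set" where
  "periods N = {1..n_periods N}"

definition targets_of :: "network \<Rightarrow> nat \<Rightarrow> nat set" where
  "targets_of N y = {x. (x, y) \<in> edges N}"

definition sources_of :: "network \<Rightarrow> nat \<Rightarrow> nat set" where
  "sources_of N x = {y. (x, y) \<in> edges N}"

definition admissible :: "network \<Rightarrow> bool" where
  "admissible N \<longleftrightarrow>
     edges N \<subseteq> targets N \<times> sources N \<and>
     (\<forall>y\<in>sources N. targets_of N y \<noteq> {}) \<and>
     (\<forall>x\<in>targets N. sources_of N x \<noteq> {}) \<and>
     (\<forall>(x, y)\<in>edges N.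
        concave_on {0..} (dfun N x y) \<and> mono_on {0..} (dfun N x y) \<and>
        concave_on {0..} (sfun N x y) \<and> mono_on {0..} (sfun N x y) \<and>
        convex_on {0..} (cfun N x y) \<and> mono_on {0..} (cfun N x y)) \<and>
     (\<forall>x\<in>targets N.
        concave_on {0..} (ffun N x) \<and> mono_on {0..} (ffun N x) \<and>
        0 \<le> weight N x \<and> 0 \<le> p_lo N x \<and> p_lo N x \<le> p_hi N x) \<and>
     (\<forall>y\<in>sources N. 0 \<le> q_lo N y \<and> q_lo N y \<le> q_hi N y) \<and>
     0 < penalty N"

text \<open>
  A real family over a finite index set is a function that is \<open>undefined\<close> outside that set, so
  that equality of families is equality of their entries; this makes uniqueness of a
  minimizer meaningful.  The entry of a full family at edge (x, y) and period t is its
  value at (x, y, t).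
\<close>

type_synonym family = "nat \<times> nat \<times> nat \<Rightarrow> real"

definition families :: "network \<Rightarrow> family set" where
  "families N = {(x, y, t). (x, y) \<in> edges N \<and> t \<in> periods N} \<rightarrow>\<^sub>E UNIV"

definition target_block :: "network \<Rightarrow> nat \<Rightarrow> family \<Rightarrow> nat \<times> nat \<Rightarrow> real" where
  "target_block N x P = restrict (\<lambda>(y, t). P (x, y, t)) (sources_of N x \<times> periods N)"

definition source_block :: "network \<Rightarrow> nat \<Rightarrow> family \<Rightarrow> nat \<times> nat \<Rightarrow> real" where
  "source_block N y P = restrict (\<lambda>(x, t). P (x, y, t)) (targets_of N y \<times> periods N)"

definition edge_block :: "network \<Rightarrow> nat \<Rightarrow> nat \<Rightarrow> family \<Rightarrow> nat \<Rightarrow> real" where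
  "edge_block N x y P = restrict (\<lambda>t. P (x, y, t)) (periods N)"

definition F_d :: "network \<Rightarrow> family set" where
  "F_d N = {Pd \<in> families N.
     (\<forall>(x, y)\<in>edges N. \<forall>t\<in>periods N. 0 \<le> Pd (x, y, t)) \<and>
     (\<forall>x\<in>targets N.
        p_lo N x \<le> (\<Sum>t\<in>periods N. \<Sum>y\<in>sources_of N x. Pd (x, y, t)) \<and>
        (\<Sum>t\<in>periods N. \<Sum>y\<in>sources_of N x. Pd (x, y, t)) \<le> p_hi N x)}"

definition F_s :: "network \<Rightarrow> family set" where
  "F_s N = {Ps \<in> families N.
     (\<forall>(x, y)\<in>edges N. \<forall>t\<in>periods N. 0 \<le> Ps (x, y, t)) \<and>
     (\<forall>y\<in>sources N.
        q_lo N y \<le> (\<Sum>t\<in>periods N. \<Sum>x\<in>targets_of N y. Ps (x, y, t)) \<and>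
        (\<Sum>t\<in>periods N. \<Sum>x\<in>targets_of N y. Ps (x, y, t)) \<le> q_hi N y)}"

definition F_target :: "network \<Rightarrow> nat \<Rightarrow> (nat \<times> nat \<Rightarrow> real) set" where
  "F_target N x = {p \<in> (sources_of N x \<times> periods N) \<rightarrow>\<^sub>E UNIV.
     (\<forall>y\<in>sources_of N x. \<forall>t\<in>periods N. 0 \<le> p (y, t)) \<and>
     p_lo N x \<le> (\<Sum>t\<in>periods N. \<Sum>y\<in>sources_of N x. p (y, t)) \<and>
     (\<Sum>t\<in>periods N. \<Sum>y\<in>sources_of N x. p (y, t)) \<le> p_hi N x}"

definition F_source :: "network \<Rightarrow> nat \<Rightarrow> (nat \<times> nat \<Rightarrow> real) set" where
  "F_source N y = {p \<in> (targets_of N y \<times> periods N) \<rightarrow>\<^sub>E UNIV.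
     (\<forall>x\<in>targets_of N y. \<forall>t\<in>periods N. 0 \<le> p (x, t)) \<and>
     q_lo N y \<le> (\<Sum>t\<in>periods N. \<Sum>x\<in>targets_of N y. p (x, t)) \<and>
     (\<Sum>t\<in>periods N. \<Sum>x\<in>targets_of N y. p (x, t)) \<le> q_hi N y}"

definition objective :: "network \<Rightarrow> family \<Rightarrow> family \<Rightarrow> real" where
  "objective N Pd Ps =
     - (\<Sum>t\<in>periods N. \<Sum>x\<in>targets N. \<Sum>y\<in>sources_of N x. dfun N x y (Pd (x, y, t)))
     - (\<Sum>t\<in>periods N. \<Sum>y\<in>sources N. \<Sum>x\<in>targets_of N y.
          sfun N x y (Ps (x, y, t)) - cfun N x y (Ps (x, y, t)))
     - (\<Sum>x\<in>targets N. weight N x *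
          ffun N x (\<Sum>t\<in>periods N. \<Sum>y\<in>sources_of N x. Pd (x, y, t)))"

definition aug_lagrangian ::
  "network \<Rightarrow> family \<Rightarrow> family \<Rightarrow> family \<Rightarrow> family \<Rightarrow> family \<Rightarrow> real" where
  "aug_lagrangian N Pd Ps P As Ad =
     objective N Pd Ps
     + (\<Sum>t\<in>periods N. \<Sum>x\<in>targets N. \<Sum>y\<in>sources_of N x.
          Ad (x, y, t) * (Pd (x, y, t) - P (x, y, t)))
     + (\<Sum>t\<in>periods N. \<Sum>y\<in>sources N. \<Sum>x\<in>targets_of N y.
          As (x, y, t) * (P (x, y, t) - Ps (x, y, t)))
     + penalty N / 2 * (\<Sum>t\<in>periods N. \<Sum>x\<in>targets N. \<Sum>y\<in>sources_of N x.
          (Pd (x, y, t) - P (x, y, t))\<^sup>2)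
     + penalty N / 2 * (\<Sum>t\<in>periods N. \<Sum>y\<in>sources N. \<Sum>x\<in>targets_of N y.
          (P (x, y, t) - Ps (x, y, t))\<^sup>2)"

definition dual_update_d :: "network \<Rightarrow> family \<Rightarrow> family \<Rightarrow> family \<Rightarrow> family \<Rightarrow> bool" where
  "dual_update_d N Pd P Ad Ad' \<longleftrightarrow>
     (\<forall>t\<in>periods N. \<forall>(x, y)\<in>edges N.
        Ad' (x, y, t) = Ad (x, y, t) + penalty N * (Pd (x, y, t) - P (x, y, t)))"

definition dual_update_s :: "network \<Rightarrow> family \<Rightarrow> family \<Rightarrow> family \<Rightarrow> family \<Rightarrow> bool" where
  "dual_update_s N Ps P As As' \<longleftrightarrow>
     (\<forall>t\<in>periods N. \<forall>(x, y)\<in>edges N.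
        As' (x, y, t) = As (x, y, t) + penalty N * (P (x, y, t) - Ps (x, y, t)))"

text \<open>
  Primes mark the next iterate.  An update written with an equality sign, "equals the arg min",
  is read as: the set of minimizers is the singleton of the new iterate.
\<close>

definition admm_step ::
  "network \<Rightarrow> family \<Rightarrow> family \<Rightarrow> family \<Rightarrow> family \<Rightarrow> family \<Rightarrow> family \<Rightarrow> family \<Rightarrow> family \<Rightarrow> bool"
where
  "admm_step N P Ad As Pd' Ps' P' Ad' As' \<longleftrightarrow>
     (Pd', Ps') \<in> argmin_set (\<lambda>(Qd, Qs). aug_lagrangian N Qd Qs P As Ad) (F_d N \<times> F_s N) \<and>
     argmin_set (\<lambda>Q. aug_lagrangian N Pd' Ps' Q As Ad) (families N) = {P'} \<and>
     dual_update_d N Pd' P' Ad Ad' \<and>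
     dual_update_s N Ps' P' As As'"

definition target_obj ::
  "network \<Rightarrow> nat \<Rightarrow> family \<Rightarrow> family \<Rightarrow> (nat \<times> nat \<Rightarrow> real) \<Rightarrow> real" where
  "target_obj N x P Ad p =
     - (\<Sum>t\<in>periods N. \<Sum>y\<in>sources_of N x. dfun N x y (p (y, t)))
     - weight N x * ffun N x (\<Sum>t\<in>periods N. \<Sum>y\<in>sources_of N x. p (y, t))
     + (\<Sum>t\<in>periods N. \<Sum>y\<in>sources_of N x. Ad (x, y, t) * p (y, t))
     + penalty N / 2 * (\<Sum>t\<in>periods N. \<Sum>y\<in>sources_of N x. (p (y, t) - P (x, y, t))\<^sup>2)"

definition source_obj ::
  "network \<Rightarrow> nat \<Rightarrow> family \<Rightarrow> family \<Rightarrow> (nat \<times> nat \<Rightarrow> real) \<Rightarrow> real" where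
  "source_obj N y P As p =
     - (\<Sum>t\<in>periods N. \<Sum>x\<in>targets_of N y. sfun N x y (p (x, t)) - cfun N x y (p (x, t)))
     - (\<Sum>t\<in>periods N. \<Sum>x\<in>targets_of N y. As (x, y, t) * p (x, t))
     + penalty N / 2 * (\<Sum>t\<in>periods N. \<Sum>x\<in>targets_of N y. (P (x, y, t) - p (x, t))\<^sup>2)"

definition edge_obj ::
  "network \<Rightarrow> nat \<Rightarrow> nat \<Rightarrow> family \<Rightarrow> family \<Rightarrow> family \<Rightarrow> family \<Rightarrow> (nat \<Rightarrow> real) \<Rightarrow> real" where
  "edge_obj N x y Pd Ps Ad As p =
     - (\<Sum>t\<in>periods N. Ad (x, y, t) * p t)
     + (\<Sum>t\<in>periods N. As (x, y, t) * p t)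
     + penalty N / 2 * (\<Sum>t\<in>periods N. (Pd (x, y, t) - p t)\<^sup>2)
     + penalty N / 2 * (\<Sum>t\<in>periods N. (p t - Ps (x, y, t))\<^sup>2)"

end

theory Submission
  imports Defs
begin

text \<open>
  Up to terms that do not depend on the variables being minimized over, the augmented Lagrangian
  is a sum of one function per target plus a sum of one function per source in step (1), and a
  sum of one function per edge in step (2).  The constraint sets are products over the same
  blocks.  A separable function on a product is minimized exactly by minimizing every block, since
  one block can be replaced while the others are kept.
\<close>

section \<open>Minimizers of separable functions\<close>

lemma mem_argmin_set:
  "z \<in> argmin_set g S \<longleftrightarrow> z \<in> S \<and> (\<forall>w\<in>S. g z \<le> g w)"
  by (auto simp: argmin_set_def is_arg_min_linorder)

text \<open>Varying one coordinate with the other fixed cancels \<open>C\<close> and the other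
  summand; conversely the two minimality inequalities add up.\<close>

lemma argmin_set_Times:
  assumes "\<And>a b. h (a, b) = C + f a + g b"
  shows "(a, b) \<in> argmin_set h (A \<times> B) \<longleftrightarrow> a \<in> argmin_set f A \<and> b \<in> argmin_set g B"
  unfolding mem_argmin_set using assms by (fastforce intro: add_mono)

text \<open>\<open>F\<close> is the ambient space and \<open>T i\<close> the feasible set of block
  \<open>i\<close>. Replacement is demanded only inside \<open>F\<close>, so one fact about families
  serves whatever constraints the blocks carry.\<close>

locale separable =
  fixes I :: "'i set" and F :: "'z set" and blk :: "'i \<Rightarrow> 'z \<Rightarrow> 'b" and T :: "'i \<Rightarrow> 'b set"
    and G :: "'z \<Rightarrow> real" and C :: real and g :: "'i \<Rightarrow> 'b \<Rightarrow> real"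
  assumes finite_I: "finite I"
    and G_eq: "\<And>z. G z = C + (\<Sum>i\<in>I. g i (blk i z))"
    and replace_block: "\<And>z i p. \<lbrakk>z \<in> F; i \<in> I; p \<in> T i\<rbrakk> \<Longrightarrow>
      \<exists>w\<in>F. blk i w = p \<and> (\<forall>j\<in>I - {i}. blk j w = blk j z)"
begin

definition S where "S = {z \<in> F. \<forall>i\<in>I. blk i z \<in> T i}"

lemma argmin_iff:
  assumes z: "z \<in> F"
  shows "z \<in> argmin_set G S \<longleftrightarrow> (\<forall>i\<in>I. blk i z \<in> argmin_set (g i) (T i))"
proof
  assume L: "z \<in> argmin_set G S"
  show "\<forall>i\<in>I. blk i z \<in> argmin_set (g i) (T i)"
    unfolding mem_argmin_set
  proof (intro ballI conjI)
    fix i assume i: "i \<in> I"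
    show "blk i z \<in> T i" using L i by (auto simp: mem_argmin_set S_def)
    fix p assume p: "p \<in> T i"
    obtain w where w: "w \<in> F" "blk i w = p" "\<forall>j\<in>I - {i}. blk j w = blk j z"
      using replace_block[OF z i p] by blast
    \<comment> \<open>Feasibility is checked block by block: the new block lies in
      \<open>T i\<close>, and the others are those of the feasible \<open>z\<close>.\<close>
    have "w \<in> S"
      using w L p unfolding S_def mem_argmin_set
      by (smt (verit) DiffI mem_Collect_eq singletonD)
    then have "G z \<le> G w" using L by (simp add: mem_argmin_set)
    moreover have "(\<Sum>j\<in>I - {i}. g j (blk j w)) = (\<Sum>j\<in>I - {i}. g j (blk j z))"
      using w by (intro sum.cong) auto
    ultimately show "g i (blk i z) \<le> g i p"
      using w by (simp add: G_eq sum.remove[OF finite_I i])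
  qed
next
  assume R: "\<forall>i\<in>I. blk i z \<in> argmin_set (g i) (T i)"
  show "z \<in> argmin_set G S"
    using R z by (auto simp: mem_argmin_set S_def G_eq intro!: sum_mono)
qed

text \<open>A second minimizer \<open>p\<close> of one block could be swapped into \<open>z\<close>,
  giving a minimizer of \<open>G\<close> that must equal \<open>z\<close>. Conversely, unique block
  minimizers force every minimizer of \<open>G\<close> to share the blocks of \<open>z\<close>, and
  \<open>blocks_determine\<close> turns this into equality.\<close>

lemma argmin_singleton_iff:
  assumes z: "z \<in> F"
    and blocks_determine: "\<And>w. \<lbrakk>w \<in> F; \<forall>i\<in>I. blk i w = blk i z\<rbrakk> \<Longrightarrow> w = z"
  shows "argmin_set G S = {z} \<longleftrightarrow> (\<forall>i\<in>I. argmin_set (g i) (T i) = {blk i z})"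
proof
  assume L: "argmin_set G S = {z}"
  then have z_min: "\<forall>i\<in>I. blk i z \<in> argmin_set (g i) (T i)"
    using argmin_iff[OF z] by blast
  have "p = blk i z" if i: "i \<in> I" and p: "p \<in> argmin_set (g i) (T i)" for i p
  proof -
    obtain w where w: "w \<in> F" "blk i w = p" "\<forall>j\<in>I - {i}. blk j w = blk j z"
      using replace_block[OF z i] p by (auto simp: mem_argmin_set)
    have "blk j w \<in> argmin_set (g j) (T j)" if "j \<in> I" for j
      using w z_min p that by (cases "j = i") auto
    then have "w \<in> argmin_set G S" using argmin_iff[OF w(1)] by blast
    with L w(2) show ?thesis by simp
  qed
  then show "\<forall>i\<in>I. argmin_set (g i) (T i) = {blk i z}" using z_min by blast
next
  assume R: "\<forall>i\<in>I. argmin_set (g i) (T i) = {blk i z}"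
  have "w = z" if w: "w \<in> argmin_set G S" for w
  proof -
    have "w \<in> F" using w by (simp add: mem_argmin_set S_def)
    then show ?thesis using argmin_iff w R blocks_determine by (metis singletonD)
  qed
  moreover have "z \<in> argmin_set G S" using argmin_iff[OF z] R by blast
  ultimately show "argmin_set G S = {z}" by blast
qed

end

section \<open>Blocks of a family\<close>

lemma replace_target_block:
  assumes "P \<in> families N" and "p \<in> (sources_of N x \<times> periods N) \<rightarrow>\<^sub>E UNIV"
  shows "\<exists>Q\<in>families N. target_block N x Q = p \<and> (\<forall>u\<in>U - {x}. target_block N u Q = target_block N u P)"
proof (intro bexI conjI ballI)
  \<comment> \<open>As \<open>p\<close> is \<open>undefined\<close> off its index set, the pasted
    function is again extensional, and restricting it returns exactly \<open>p\<close>.\<close>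
  let ?Q = "\<lambda>(u, y, t). if u = x then p (y, t) else P (u, y, t)"
  show "?Q \<in> families N"
    using assms by (auto simp: families_def sources_of_def PiE_iff extensional_def)
  show "target_block N x ?Q = p"
    using assms(2) by (auto simp: target_block_def restrict_def PiE_iff extensional_def fun_eq_iff)
  show "target_block N u ?Q = target_block N u P" if "u \<in> U - {x}" for u
    using that by (auto simp: target_block_def restrict_def fun_eq_iff)
qed

lemma replace_source_block:
  assumes "P \<in> families N" and "p \<in> (targets_of N y \<times> periods N) \<rightarrow>\<^sub>E UNIV"
  shows "\<exists>Q\<in>families N. source_block N y Q = p \<and> (\<forall>u\<in>U - {y}. source_block N u Q = source_block N u P)"
proof (intro bexI conjI ballI)
  let ?Q = "\<lambda>(x, u, t). if u = y then p (x, t) else P (x, u, t)"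
  show "?Q \<in> families N"
    using assms by (auto simp: families_def targets_of_def PiE_iff extensional_def)
  show "source_block N y ?Q = p"
    using assms(2) by (auto simp: source_block_def restrict_def PiE_iff extensional_def fun_eq_iff)
  show "source_block N u ?Q = source_block N u P" if "u \<in> U - {y}" for u
    using that by (auto simp: source_block_def restrict_def fun_eq_iff)
qed

text \<open>The edge hypothesis keeps the pasted values inside the index set of
  \<open>families N\<close>; for the other two kinds of block, \<open>sources_of\<close> and
  \<open>targets_of\<close> ensure this.\<close>

lemma replace_edge_block:
  assumes "P \<in> families N" and "p \<in> periods N \<rightarrow>\<^sub>E UNIV" and "(x, y) \<in> edges N"
  shows "\<exists>Q\<in>families N. edge_block N x y Q = p \<and>
    (\<forall>(u, v)\<in>U - {(x, y)}. edge_block N u v Q = edge_block N u v P)"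
proof (intro bexI conjI ballI)
  let ?Q = "\<lambda>(u, v, t). if (u, v) = (x, y) then p t else P (u, v, t)"
  show "?Q \<in> families N"
    using assms by (auto simp: families_def PiE_iff extensional_def)
  show "edge_block N x y ?Q = p"
    using assms(2) by (auto simp: edge_block_def restrict_def PiE_iff extensional_def fun_eq_iff)
  show "case e of (u, v) \<Rightarrow> edge_block N u v ?Q = edge_block N u v P" if "e \<in> U - {(x, y)}" for e
    using that by (auto simp: edge_block_def restrict_def fun_eq_iff)
qed

text \<open>Supplies \<open>blocks_determine\<close> for edge blocks: these cover every entry, and
  off the index set both families are \<open>undefined\<close>.\<close>

lemma families_eqI:
  assumes P: "P \<in> families N" and Q: "Q \<in> families N"
    and blocks: "\<And>x y. (x, y) \<in> edges N \<Longrightarrow> edge_block N x y P = edge_block N x y Q"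
  shows "P = Q"
proof -
  have "P (x, y, t) = Q (x, y, t)" if "(x, y) \<in> edges N" "t \<in> periods N" for x y t
    using fun_cong[OF blocks[OF that(1)], of t] that(2) by (simp add: edge_block_def)
  then show ?thesis
    using P Q unfolding families_def by (intro PiE_ext) auto
qed

lemma edge_endpoints:
  "admissible N \<Longrightarrow> (x, y) \<in> edges N \<Longrightarrow> x \<in> targets N \<and> y \<in> sources N"
  by (auto simp: admissible_def)

lemma F_target_block_iff:
  "target_block N x P \<in> F_target N x \<longleftrightarrow>
     (\<forall>y\<in>sources_of N x. \<forall>t\<in>periods N. 0 \<le> P (x, y, t)) \<and>
     p_lo N x \<le> (\<Sum>t\<in>periods N. \<Sum>y\<in>sources_of N x. P (x, y, t)) \<and>
     (\<Sum>t\<in>periods N. \<Sum>y\<in>sources_of N x. P (x, y, t)) \<le> p_hi N x"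
  by (simp add: F_target_def target_block_def)

lemma F_source_block_iff:
  "source_block N y P \<in> F_source N y \<longleftrightarrow>
     (\<forall>x\<in>targets_of N y. \<forall>t\<in>periods N. 0 \<le> P (x, y, t)) \<and>
     q_lo N y \<le> (\<Sum>t\<in>periods N. \<Sum>x\<in>targets_of N y. P (x, y, t)) \<and>
     (\<Sum>t\<in>periods N. \<Sum>x\<in>targets_of N y. P (x, y, t)) \<le> q_hi N y"
  by (simp add: F_source_def source_block_def)

text \<open>The bounds are already stated per target; nonnegativity on all edges splits over targets
  because admissibility places the first endpoint of each edge in \<open>targets N\<close>.\<close>

lemma F_d_blocks:
  "admissible N \<Longrightarrow>
   F_d N = {P \<in> families N. \<forall>x\<in>targets N. target_block N x P \<in> F_target N x}"
  unfolding F_target_block_iff F_d_def sources_of_def by (fastforce dest: edge_endpoints)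

lemma F_s_blocks:
  "admissible N \<Longrightarrow>
   F_s N = {P \<in> families N. \<forall>y\<in>sources N. source_block N y P \<in> F_source N y}"
  unfolding F_source_block_iff F_s_def targets_of_def by (fastforce dest: edge_endpoints)

section \<open>Splitting the augmented Lagrangian\<close>

lemma target_obj_block:
  "target_obj N x P Ad (target_block N x Q) =
     - (\<Sum>t\<in>periods N. \<Sum>y\<in>sources_of N x. dfun N x y (Q (x, y, t)))
     - weight N x * ffun N x (\<Sum>t\<in>periods N. \<Sum>y\<in>sources_of N x. Q (x, y, t))
     + (\<Sum>t\<in>periods N. \<Sum>y\<in>sources_of N x. Ad (x, y, t) * Q (x, y, t))
     + penalty N / 2 * (\<Sum>t\<in>periods N. \<Sum>y\<in>sources_of N x. (Q (x, y, t) - P (x, y, t))\<^sup>2)"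
  by (simp add: target_obj_def target_block_def)

lemma source_obj_block:
  "source_obj N y P As (source_block N y Q) =
     - (\<Sum>t\<in>periods N. \<Sum>x\<in>targets_of N y. sfun N x y (Q (x, y, t)) - cfun N x y (Q (x, y, t)))
     - (\<Sum>t\<in>periods N. \<Sum>x\<in>targets_of N y. As (x, y, t) * Q (x, y, t))
     + penalty N / 2 * (\<Sum>t\<in>periods N. \<Sum>x\<in>targets_of N y. (P (x, y, t) - Q (x, y, t))\<^sup>2)"
  by (simp add: source_obj_def source_block_def)

lemma edge_obj_block:
  "edge_obj N x y Pd Ps Ad As (edge_block N x y Q) =
     - (\<Sum>t\<in>periods N. Ad (x, y, t) * Q (x, y, t))
     + (\<Sum>t\<in>periods N. As (x, y, t) * Q (x, y, t))
     + penalty N / 2 * (\<Sum>t\<in>periods N. (Pd (x, y, t) - Q (x, y, t))\<^sup>2)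
     + penalty N / 2 * (\<Sum>t\<in>periods N. (Q (x, y, t) - Ps (x, y, t))\<^sup>2)"
  by (simp add: edge_obj_def edge_block_def)

text \<open>The only terms that belong to no block are the multiplier terms in \<open>P\<close>,
  which is fixed in step (1). Each quadratic penalty involves just one of \<open>Qd\<close> and
  \<open>Qs\<close>.\<close>

lemma aug_lagrangian_target_source:
  "aug_lagrangian N Qd Qs P As Ad =
     ((\<Sum>t\<in>periods N. \<Sum>y\<in>sources N. \<Sum>x\<in>targets_of N y. As (x, y, t) * P (x, y, t))
      - (\<Sum>t\<in>periods N. \<Sum>x\<in>targets N. \<Sum>y\<in>sources_of N x. Ad (x, y, t) * P (x, y, t)))
     + (\<Sum>x\<in>targets N. target_obj N x P Ad (target_block N x Qd))
     + (\<Sum>y\<in>sources N. source_obj N y P As (source_block N y Qs))"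
  \<comment> \<open>Naming both index sets fixes the direction of each exchange of sums, so the
    rewriting cannot loop.\<close>
  unfolding aug_lagrangian_def objective_def target_obj_block source_obj_block
    sum.swap[of _ "targets N" "periods N"] sum.swap[of _ "sources N" "periods N"]
  by (simp add: sum.distrib sum_subtractf sum_negf right_diff_distrib sum_distrib_left
      sum.swap[of _ "targets N" "periods N"] sum.swap[of _ "sources N" "periods N"])

text \<open>In step (2) the demand and supply terms share the variable of an edge, so the sums
  grouped by target and those grouped by source are brought to the common index set
  \<open>edges N\<close>.\<close>

lemma
  assumes "admissible N"
  shows sum_targets_eq_edges:
      "(\<Sum>x\<in>targets N. \<Sum>y\<in>sources_of N x. h x y) = (\<Sum>(x, y)\<in>edges N. h x y)" (is ?A)
    and sum_sources_eq_edges: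
      "(\<Sum>y\<in>sources N. \<Sum>x\<in>targets_of N y. h x y) = (\<Sum>(x, y)\<in>edges N. h x y)" (is ?B)
    and finite_edges: "finite (edges N)"
proof -
  have sub: "edges N \<subseteq> targets N \<times> sources N"
    using assms by (simp add: admissible_def)
  have fin: "finite (targets N)" "finite (sources N)"
    by (simp_all add: targets_def sources_def)
  show "finite (edges N)" using sub fin finite_subset by blast
  have "finite (sources_of N x)" for x
    using sub by (intro finite_subset[OF _ fin(2)]) (auto simp: sources_of_def)
  moreover have "Sigma (targets N) (sources_of N) = edges N"
    using sub by (auto simp: sources_of_def)
  ultimately show ?A using fin by (simp add: sum.Sigma)
  have "finite (targets_of N y)" for y
    using sub by (intro finite_subset[OF _ fin(1)]) (auto simp: targets_of_def)
  then have "(\<Sum>y\<in>sources N. \<Sum>x\<in>targets_of N y. h x y)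
      = (\<Sum>(y, x)\<in>Sigma (sources N) (targets_of N). h x y)"
    using fin by (simp add: sum.Sigma)
  \<comment> \<open>Grouping by source lists each edge as \<open>(y, x)\<close>, hence the
    reindexing along the injective swap.\<close>
  also have "Sigma (sources N) (targets_of N) = prod.swap ` edges N"
    using sub by (force simp: targets_of_def)
  also have "(\<Sum>(y, x)\<in>prod.swap ` edges N. h x y) = (\<Sum>(x, y)\<in>edges N. h x y)"
    by (subst sum.reindex) (auto simp: case_prod_unfold)
  finally show ?B .
qed

text \<open>With \<open>Pd\<close> and \<open>Ps\<close> fixed, the objective and their multiplier
  terms form the constant. The squares stay whole inside \<open>edge_obj\<close>.\<close>

lemma aug_lagrangian_edge:
  assumes "admissible N"
  shows "aug_lagrangian N Pd Ps Q As Ad =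
     (objective N Pd Ps
      + (\<Sum>t\<in>periods N. \<Sum>(x, y)\<in>edges N. Ad (x, y, t) * Pd (x, y, t))
      - (\<Sum>t\<in>periods N. \<Sum>(x, y)\<in>edges N. As (x, y, t) * Ps (x, y, t)))
     + (\<Sum>(x, y)\<in>edges N. edge_obj N x y Pd Ps Ad As (edge_block N x y Q))"
  unfolding aug_lagrangian_def edge_obj_block
    sum_targets_eq_edges[OF assms] sum_sources_eq_edges[OF assms]
  by (simp add: case_prod_unfold sum.distrib sum_subtractf sum_negf right_diff_distrib
      sum_distrib_left sum.swap[of _ "edges N" "periods N"])

section \<open>Equivalence of the two iterations\<close>

lemma argmin_F_d_iff:
  assumes adm: "admissible N" and Q: "Q \<in> families N"
  shows "Q \<in> argmin_set (\<lambda>Q. \<Sum>x\<in>targets N. target_obj N x P Ad (target_block N x Q)) (F_d N)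
    \<longleftrightarrow> (\<forall>x\<in>targets N. target_block N x Q \<in> argmin_set (target_obj N x P Ad) (F_target N x))"
proof -
  \<comment> \<open>The constant is 0 here, since \<open>argmin_set_Times\<close> absorbs the terms
    in \<open>P\<close> beforehand.\<close>
  interpret separable "targets N" "families N" "target_block N" "F_target N"
    "\<lambda>Q. \<Sum>x\<in>targets N. target_obj N x P Ad (target_block N x Q)" 0 "\<lambda>x. target_obj N x P Ad"
    by unfold_locales (auto simp: targets_def F_target_def intro!: replace_target_block)
  show ?thesis using argmin_iff[OF Q] by (simp add: S_def F_d_blocks[OF adm])
qed

lemma argmin_F_s_iff:
  assumes adm: "admissible N" and Q: "Q \<in> families N"
  shows "Q \<in> argmin_set (\<lambda>Q. \<Sum>y\<in>sources N. source_obj N y P As (source_block N y Q)) (F_s N)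
    \<longleftrightarrow> (\<forall>y\<in>sources N. source_block N y Q \<in> argmin_set (source_obj N y P As) (F_source N y))"
proof -
  interpret separable "sources N" "families N" "source_block N" "F_source N"
    "\<lambda>Q. \<Sum>y\<in>sources N. source_obj N y P As (source_block N y Q)" 0 "\<lambda>y. source_obj N y P As"
    by unfold_locales (auto simp: sources_def F_source_def intro!: replace_source_block)
  show ?thesis using argmin_iff[OF Q] by (simp add: S_def F_s_blocks[OF adm])
qed

lemma argmin_consensus_iff:
  assumes adm: "admissible N" and P': "P' \<in> families N"
  shows "argmin_set (\<lambda>Q. aug_lagrangian N Pd Ps Q As Ad) (families N) = {P'} \<longleftrightarrow>
    (\<forall>(x, y)\<in>edges N. argmin_set (edge_obj N x y Pd Ps Ad As) (periods N \<rightarrow>\<^sub>E UNIV)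
       = {edge_block N x y P'})"
proof -
  interpret separable "edges N" "families N" "\<lambda>(x, y). edge_block N x y"
    "\<lambda>_. periods N \<rightarrow>\<^sub>E UNIV" "\<lambda>Q. aug_lagrangian N Pd Ps Q As Ad"
    "objective N Pd Ps
      + (\<Sum>t\<in>periods N. \<Sum>(x, y)\<in>edges N. Ad (x, y, t) * Pd (x, y, t))
      - (\<Sum>t\<in>periods N. \<Sum>(x, y)\<in>edges N. As (x, y, t) * Ps (x, y, t))"
    "\<lambda>(x, y). edge_obj N x y Pd Ps Ad As"
  proof
    show "finite (edges N)" using finite_edges[OF adm] .
    fix z e and p :: "nat \<Rightarrow> real"
    show "aug_lagrangian N Pd Ps z As Ad = objective N Pd Ps
      + (\<Sum>t\<in>periods N. \<Sum>(x, y)\<in>edges N. Ad (x, y, t) * Pd (x, y, t))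
      - (\<Sum>t\<in>periods N. \<Sum>(x, y)\<in>edges N. As (x, y, t) * Ps (x, y, t))
      + (\<Sum>i\<in>edges N. (case i of (x, y) \<Rightarrow> edge_obj N x y Pd Ps Ad As)
           ((case i of (x, y) \<Rightarrow> edge_block N x y) z))"
      by (simp add: aug_lagrangian_edge[OF adm] case_prod_unfold)
    assume "z \<in> families N" "e \<in> edges N" "p \<in> periods N \<rightarrow>\<^sub>E UNIV"
    then show "\<exists>w\<in>families N. (case e of (x, y) \<Rightarrow> edge_block N x y) w = p \<and>
        (\<forall>j\<in>edges N - {e}. (case j of (x, y) \<Rightarrow> edge_block N x y) w
           = (case j of (x, y) \<Rightarrow> edge_block N x y) z)"
      using replace_edge_block[of z N p "fst e" "snd e" "edges N"]
      by (simp add: case_prod_unfold)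
  qed
  \<comment> \<open>Every edge block is a restriction to \<open>periods N\<close>, so membership in
    the block sets imposes no constraint.\<close>
  have "S = families N" by (auto simp: S_def edge_block_def)
  moreover have "w = P'"
    if "w \<in> families N"
      "\<forall>i\<in>edges N. (case i of (x, y) \<Rightarrow> edge_block N x y) w = (case i of (x, y) \<Rightarrow> edge_block N x y) P'"
    for w using that by (intro families_eqI[OF _ P']) auto
  ultimately show ?thesis using argmin_singleton_iff[OF P'] by (simp add: case_prod_unfold)
qed

text \<open>The new iterates \<open>Pd'\<close> and \<open>Ps'\<close> enter step (2) as fixed data
  on both sides, so the two minimizations translate independently; the multiplier updates
  coincide.\<close>

lemma admm_step_iff:
  assumes adm: "admissible N" and fam: "Pd' \<in> families N" "Ps' \<in> families N" "P' \<in> families N"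
  shows "admm_step N P Ad As Pd' Ps' P' Ad' As' \<longleftrightarrow>
    (\<forall>x\<in>targets N. target_block N x Pd' \<in> argmin_set (target_obj N x P Ad) (F_target N x)) \<and>
    (\<forall>y\<in>sources N. source_block N y Ps' \<in> argmin_set (source_obj N y P As) (F_source N y)) \<and>
    (\<forall>(x, y)\<in>edges N. argmin_set (edge_obj N x y Pd' Ps' Ad As) (periods N \<rightarrow>\<^sub>E UNIV)
       = {edge_block N x y P'}) \<and>
    dual_update_d N Pd' P' Ad Ad' \<and> dual_update_s N Ps' P' As As'"
proof -
  have "(Pd', Ps') \<in> argmin_set (\<lambda>(Qd, Qs). aug_lagrangian N Qd Qs P As Ad) (F_d N \<times> F_s N) \<longleftrightarrow>
      Pd' \<in> argmin_set (\<lambda>Q. \<Sum>x\<in>targets N. target_obj N x P Ad (target_block N x Q)) (F_d N) \<and>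
      Ps' \<in> argmin_set (\<lambda>Q. \<Sum>y\<in>sources N. source_obj N y P As (source_block N y Q)) (F_s N)"
    \<comment> \<open>Unification with the splitting equation determines \<open>C\<close>,
      \<open>f\<close> and \<open>g\<close>.\<close>
    by (rule argmin_set_Times) (unfold case_prod_conv, rule aug_lagrangian_target_source)
  then show ?thesis
    unfolding admm_step_def
    by (simp only: argmin_F_d_iff[OF adm fam(1)] argmin_F_s_iff[OF adm fam(2)]
        argmin_consensus_iff[OF adm fam(3)] conj_assoc)
qed

theorem proposition1:
  fixes N :: network and Pd Ps P Ad As :: "nat \<Rightarrow> family"
  assumes "admissible N"
    and "\<And>k. Pd k \<in> families N" and "\<And>k. Ps k \<in> families N" and "\<And>k. P k \<in> families N"
    and "\<And>k. Ad k \<in> families N" and "\<And>k. As k \<in> families N"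
  shows "(\<forall>k. admm_step N (P k) (Ad k) (As k)
                (Pd (Suc k)) (Ps (Suc k)) (P (Suc k)) (Ad (Suc k)) (As (Suc k)))
    \<longleftrightarrow>
    (\<forall>k.
      (\<forall>x\<in>targets N. target_block N x (Pd (Suc k))
          \<in> argmin_set (target_obj N x (P k) (Ad k)) (F_target N x)) \<and>
      (\<forall>y\<in>sources N. source_block N y (Ps (Suc k))
          \<in> argmin_set (source_obj N y (P k) (As k)) (F_source N y)) \<and>
      (\<forall>(x, y)\<in>edges N.
          argmin_set (edge_obj N x y (Pd (Suc k)) (Ps (Suc k)) (Ad k) (As k))
            (periods N \<rightarrow>\<^sub>E UNIV) = {edge_block N x y (P (Suc k))}) \<and>
      (\<forall>t\<in>periods N. \<forall>(x, y)\<in>edges N.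
          Ad (Suc k) (x, y, t)
            = Ad k (x, y, t) + penalty N * (Pd (Suc k) (x, y, t) - P (Suc k) (x, y, t))) \<and>
      (\<forall>t\<in>periods N. \<forall>(x, y)\<in>edges N.
          As (Suc k) (x, y, t)
            = As k (x, y, t) + penalty N * (P (Suc k) (x, y, t) - Ps (Suc k) (x, y, t))))"
  \<comment> \<open>The conditions agree for each single \<open>k\<close>, so rewriting under the
    quantifier suffices.\<close>
  by (simp only: admm_step_iff[OF assms(1-4)] dual_update_d_def dual_update_s_def)

end
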